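(* For any two sequences of complex numbers $\{\alpha_n\}_{n\ge1}$ and $\{\beta_n\}_{n\ge1}$ the following two conditions are equivalent: $$\alpha_n=\frac{(-1)^{n+1}}{(n+1)!}\sum_{k_1+2k_2+\cdots+nk_n=n}\frac{(k_1+\cdots+k_n+n)!}{k_1!\cdots k_n!}\beta_1^{k_1}\cdots\beta_n^{k_n}\quad\text{for all } n\ge 1$$ and $$\beta_n=\frac{(-1)^{n+1}}{(n+1)!}\sum_{k_1+2k_2+\cdots+nk_n=n}\frac{(k_1+\cdots+k_n+n)!}{k_1!\cdots k_n!}\alpha_1^{k_1}\cdots\alpha_n^{k_n}\quad\text{for all } n\ge 1.$$
   Context: The sums run over all $n$-tuples $(k_1,\ldots,k_n)$ of nonnegative integers with $k_1+2k_2+\cdots+nk_n=n$. *)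

theory Defs
  imports Complex_Main "HOL-Library.FuncSet"
begin

text \<open>
  An n-tuple \<open>(k\<^sub>1, \<dots>, k\<^sub>n)\<close> of nonnegative integers is an extensional function on
  \<open>{1..n}\<close>; fixing the value outside \<open>{1..n}\<close> makes each tuple occur exactly once.
\<close>

definition weighted_tuples :: "nat \<Rightarrow> (nat \<Rightarrow> nat) set" where
  "weighted_tuples n = {k \<in> {1..n} \<rightarrow>\<^sub>E UNIV. (\<Sum>i=1..n. i * k i) = n}"

text \<open>Sums over \<open>weighted_tuples n\<close> are genuine finite sums.\<close>

lemma finite_weighted_tuples: "finite (weighted_tuples n)"
proof (rule finite_subset)
  show "weighted_tuples n \<subseteq> {1..n} \<rightarrow>\<^sub>E {..n}"
  proof
    fix k assume k: "k \<in> weighted_tuples n"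
    have "k i \<le> n" if i: "i \<in> {1..n}" for i
    proof -
      have "k i \<le> i * k i" using i by simp
      also have "\<dots> \<le> (\<Sum>j=1..n. j * k j)"
        by (rule member_le_sum[OF i]) auto
      also have "\<dots> = n" using k by (simp add: weighted_tuples_def)
      finally show ?thesis .
    qed
    then show "k \<in> {1..n} \<rightarrow>\<^sub>E {..n}"
      using k by (auto simp: weighted_tuples_def PiE_iff)
  qed
  show "finite ({1..n} \<rightarrow>\<^sub>E {..n})" by (intro finite_PiE) auto
qed

end

theory Submission
  imports Defs "HOL-Computational_Algebra.Formal_Power_Series"
begin

text \<open>
  Put \<open>A = \<Sum> \<alpha>\<^sub>n X\<^sup>n\<close>, \<open>B = \<Sum> \<beta>\<^sub>n X\<^sup>n\<close>, and let \<open>G\<close> be the compositional inverse of \<open>X (1 - B)\<close>.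
  Grouping the tuples by \<open>m = k\<^sub>1 + \<dots> + k\<^sub>n\<close>, the multinomial theorem turns the sum over the
  tuples into \<open>\<Sum>\<^sub>m (m + n)! / m! [X\<^sup>n] B\<^sup>m = n! [X\<^sup>n] 1 / (1 - B)\<^bsup>n+1\<^esup>\<close>, which by Lagrange inversion is
  \<open>(n + 1)! [X\<^bsup>n+1\<^esup>] G\<close>. Hence the first condition says \<open>X (1 - A) = - G(- X)\<close>: the series
  \<open>X (1 - A)\<close> is the inverse of \<open>X (1 - B)\<close> conjugated by the involution \<open>X \<mapsto> - X\<close>, and this
  relation between \<open>A\<close> and \<open>B\<close> is symmetric.
\<close>

unbundle fps_syntax

section \<open>Lagrange inversion\<close>

text \<open>With \<open>F = fps_X * u\<close>, \<open>inverse u\<close> plays the role of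
  \<open>X / F\<close>, so the coefficient is the residue of \<open>F^(i-n-1) F'\<close>. This is
  the derivative of a Laurent series unless \<open>i = n\<close>, when it is the logarithmic
  derivative of a series of order 1. The proof expresses this without negative powers.\<close>

lemma Lagrange_orthogonality:
  fixes u :: "'a::field_char_0 fps"
  assumes u0: "u $ 0 \<noteq> 0" and "i \<le> n"
  shows "((fps_X * u) ^ i * fps_deriv (fps_X * u) * inverse u ^ Suc n) $ n = (if i = n then 1 else 0)"
proof -
  define w where "w = inverse u"
  define j where "j = n - i"
  have n: "n = i + j" using \<open>i \<le> n\<close> by (simp add: j_def)
  have uw: "u * w = 1" unfolding w_def using u0 by (rule inverse_mult_eq_1')
  have dw: "fps_deriv w = - fps_deriv u * w\<^sup>2"
    unfolding w_def using u0 by (simp add: fps_inverse_deriv power2_eq_square)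
  have "(fps_X * u) ^ i * fps_deriv (fps_X * u) * w ^ Suc n
      = fps_X ^ i * ((u * w) ^ i * ((u * w) * w ^ j + fps_X * (fps_deriv u * w ^ Suc j)))"
    by (simp add: n power_mult_distrib power_add algebra_simps)
  also have "\<dots> = fps_X ^ i * (w ^ j + fps_X * (fps_deriv u * w ^ Suc j))"
    by (simp add: uw)
  finally have "((fps_X * u) ^ i * fps_deriv (fps_X * u) * w ^ Suc n) $ n
      = (w ^ j + fps_X * (fps_deriv u * w ^ Suc j)) $ j"
    by (simp add: fps_X_power_mult_nth n)
  also have "\<dots> = (if j = 0 then 1 else 0)"
  proof (cases j)
    case (Suc l)
    \<comment> \<open>For \<open>j > 0\<close> the two summands cancel in degree \<open>j\<close>:
      comparing coefficients of \<open>(w^j)' = - j u' w^(j+1)\<close> in degree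
      \<open>l = j - 1\<close> gives \<open>j\<close> times the required identity, and
      \<open>j\<close> is invertible in characteristic 0.\<close>
    have "fps_deriv (w ^ j) = - of_nat j * (fps_deriv u * w ^ Suc j)"
      by (subst fps_deriv_power') (simp add: Suc dw power2_eq_square algebra_simps del: of_nat_Suc)
    then have "fps_deriv (w ^ j) $ l = (- of_nat j * (fps_deriv u * w ^ Suc j)) $ l"
      by simp
    also have "\<dots> = - of_nat j * (fps_deriv u * w ^ Suc j) $ l"
      by (simp add: fps_of_nat [symmetric] fps_const_neg[symmetric] del: fps_const_neg of_nat_Suc power_Suc)
    finally have "of_nat j * (w ^ j) $ j = of_nat j * (- (fps_deriv u * w ^ Suc j) $ l)"
      by (simp add: Suc del: of_nat_Suc power_Suc)
    then have "(w ^ j) $ j = - (fps_deriv u * w ^ Suc j) $ l"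
      unfolding mult_cancel_left by (simp add: Suc del: of_nat_Suc power_Suc)
    then show ?thesis by (simp add: Suc del: power_Suc)
  qed simp
  finally show ?thesis by (simp add: w_def n)
qed

text \<open>The chain rule gives \<open>(G oo F) * F' = 1\<close> for the derivative
  \<open>G\<close> of the inverse series. Inserting this factor and expanding \<open>G oo F\<close>
  in powers of \<open>F\<close>, orthogonality leaves only the term \<open>G $ n\<close>.\<close>

theorem Lagrange_inversion:
  fixes u :: "'a::field_char_0 fps"
  assumes u0: "u $ 0 \<noteq> 0"
  shows "of_nat (Suc n) * fps_inv (fps_X * u) $ Suc n = (inverse u ^ Suc n) $ n"
proof -
  define F where "F = fps_X * u"
  define G where "G = fps_deriv (fps_inv F)"
  define V where "V = fps_deriv F * inverse u ^ Suc n"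
  have F0: "F $ 0 = 0" and F1: "F $ 1 \<noteq> 0" using u0 by (simp_all add: F_def)
  have "fps_deriv (fps_inv F oo F) = 1" using fps_inv[OF F0 F1] by simp
  then have one: "(G oo F) * fps_deriv F = 1"
    by (simp add: fps_compose_deriv[OF F0] G_def)
  \<comment> \<open>Since \<open>F ^ i\<close> starts in degree \<open>i\<close> or later, the range
    of \<open>i\<close> can be made independent of \<open>k\<close>, which permits swapping the
    sums.\<close>
  have nth: "(G oo F) $ k = (\<Sum>i\<le>n. G $ i * (F ^ i) $ k)" if "k \<le> n" for k
    unfolding fps_compose_nth atLeast0AtMost
    by (rule sum.mono_neutral_left) (use that in \<open>auto simp: startsby_zero_power_prefix[OF F0]\<close>)
  have "(inverse u ^ Suc n) $ n = ((G oo F) * V) $ n"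
    using one by (simp add: V_def mult.assoc[symmetric] del: power_Suc)
  also have "\<dots> = (\<Sum>k\<le>n. \<Sum>i\<le>n. G $ i * (F ^ i) $ k * V $ (n - k))"
    by (simp add: fps_mult_nth atLeast0AtMost nth sum_distrib_right)
  also have "\<dots> = (\<Sum>i\<le>n. G $ i * (F ^ i * V) $ n)"
    by (subst sum.swap) (simp add: fps_mult_nth atLeast0AtMost sum_distrib_left mult.assoc)
  also have "\<dots> = (\<Sum>i\<le>n. if i = n then G $ i else 0)"
    by (intro sum.cong refl, unfold V_def F_def mult.assoc[symmetric], subst Lagrange_orthogonality[OF u0])
       auto
  also have "\<dots> = G $ n" by simp
  finally show ?thesis by (simp add: G_def F_def)
qed

section \<open>Coefficients of powers\<close>

definition tuples_of_sum :: "'b set \<Rightarrow> nat \<Rightarrow> ('b \<Rightarrow> nat) set" where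
  "tuples_of_sum A m = {k \<in> A \<rightarrow>\<^sub>E UNIV. sum k A = m}"

lemma finite_tuples_of_sum:
  assumes "finite A"
  shows "finite (tuples_of_sum A m)"
proof (rule finite_subset)
  show "tuples_of_sum A m \<subseteq> A \<rightarrow>\<^sub>E {..m}"
    using assms by (auto simp: tuples_of_sum_def PiE_iff intro: member_le_sum dest: extensional_arb)
  show "finite (A \<rightarrow>\<^sub>E {..m})" using assms by (intro finite_PiE) auto
qed

text \<open>Induction on the index set: the binomial theorem splits off \<open>x a\<close>, and its
  coefficient supplies the factorials that join the exponent of \<open>x a\<close> to the remaining
  tuple.\<close>

lemma fps_multinomial:
  fixes x :: "'b \<Rightarrow> 'a::field_char_0 fps"
  assumes "finite A"
  shows "(\<Sum>i\<in>A. x i) ^ m =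
    fps_const (fact m) * (\<Sum>k\<in>tuples_of_sum A m. \<Prod>i\<in>A. fps_const (inverse (fact (k i))) * x i ^ k i)"
  using assms
proof (induction A arbitrary: m rule: finite_induct)
  case empty
  then show ?case by (cases m) (auto simp: tuples_of_sum_def)
next
  case (insert a A)
  define T where "T k i = fps_const (inverse (fact (k i))) * x i ^ k i" for k :: "'b \<Rightarrow> nat" and i
  have coeff: "of_nat (m choose j) * fps_const (fact (m - j)) =
      fps_const (fact m) * fps_const (inverse (fact j) :: 'a)" if "j \<le> m" for j
    using that by (simp add: fps_of_nat [symmetric] binomial_fact field_simps)
  have "(\<Sum>i\<in>insert a A. x i) ^ m = (x a + (\<Sum>i\<in>A. x i)) ^ m"
    using insert.hyps by simp
  also have "\<dots> = (\<Sum>j\<le>m. of_nat (m choose j) * x a ^ j * (\<Sum>i\<in>A. x i) ^ (m - j))"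
    by (rule binomial_ring)
  also have "\<dots> = (\<Sum>j\<le>m. (of_nat (m choose j) * fps_const (fact (m - j))) *
      (x a ^ j * (\<Sum>k\<in>tuples_of_sum A (m - j). \<Prod>i\<in>A. T k i)))"
    by (simp add: insert.IH T_def mult_ac)
  also have "\<dots> = (\<Sum>j\<le>m. fps_const (fact m) * fps_const (inverse (fact j)) *
      (x a ^ j * (\<Sum>k\<in>tuples_of_sum A (m - j). \<Prod>i\<in>A. T k i)))"
    by (intro sum.cong refl) (simp add: coeff del: fps_const_mult)
  also have "\<dots> = fps_const (fact m) * (\<Sum>j\<le>m. \<Sum>k\<in>tuples_of_sum A (m - j).
      fps_const (inverse (fact j)) * x a ^ j * (\<Prod>i\<in>A. T k i))"
    by (simp add: sum_distrib_left mult.assoc del: fps_const_mult)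
  also have "(\<Sum>j\<le>m. \<Sum>k\<in>tuples_of_sum A (m - j).
        fps_const (inverse (fact j)) * x a ^ j * (\<Prod>i\<in>A. T k i)) =
      (\<Sum>(j,k)\<in>(SIGMA j:{..m}. tuples_of_sum A (m - j)).
        fps_const (inverse (fact j)) * x a ^ j * (\<Prod>i\<in>A. T k i))"
    by (rule sum.Sigma) (auto intro: finite_tuples_of_sum insert.hyps)
  \<comment> \<open>A tuple on \<open>insert a A\<close> is its value at \<open>a\<close> together
    with its restriction to \<open>A\<close>; resetting \<open>a\<close> to \<open>undefined\<close>
    keeps the restriction extensional.\<close>
  also have "\<dots> = (\<Sum>k\<in>tuples_of_sum (insert a A) m. \<Prod>i\<in>insert a A. T k i)"
  proof (rule sum.reindex_bij_witness[where i = "\<lambda>k. (k a, k(a := undefined))" and j = "\<lambda>(j, k). k(a := j)"],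
      goal_cases)
    case (1 p)
    then show ?case using insert.hyps
      by (auto simp: tuples_of_sum_def PiE_iff extensional_def fun_eq_iff)
  next
    case (2 p)
    have "sum (\<lambda>i. if i = a then j else k i) A = sum k A" for j :: nat and k
      using insert.hyps by (intro sum.cong) auto
    with 2 show ?case using insert.hyps
      by (auto simp: tuples_of_sum_def PiE_iff extensional_def fun_upd_def)
  next
    case (3 k)
    then show ?case by simp
  next
    case (4 k)
    have "sum (\<lambda>i. if i = a then undefined else k i) A = sum k A"
      using insert.hyps by (intro sum.cong) auto
    with 4 show ?case using insert.hyps
      by (auto simp: tuples_of_sum_def PiE_iff extensional_def fun_upd_def)
  next
    case (5 p)
    obtain j k where p: "p = (j, k)" by fastforce
    have "(\<Prod>i\<in>A. T (k(a := j)) i) = (\<Prod>i\<in>A. T k i)"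
      using insert.hyps by (intro prod.cong) (auto simp: T_def)
    then show ?case using insert.hyps by (simp add: p T_def)
  qed
  finally show ?case by (simp add: T_def)
qed

text \<open>This permits truncating a series to finitely many monomials, so that the multinomial
  theorem applies.\<close>

lemma fps_power_nth_cong:
  fixes f g :: "'a::comm_semiring_1 fps"
  assumes "\<And>i. i \<le> n \<Longrightarrow> f $ i = g $ i" and "j \<le> n"
  shows "(f ^ m) $ j = (g ^ m) $ j"
  using \<open>j \<le> n\<close>
proof (induction m arbitrary: j)
  case (Suc m)
  then show ?case by (auto simp: fps_mult_nth assms(1) intro!: sum.cong)
qed simp

text \<open>The conditions ignore index 0. Constant term 0 lets the series be substituted into
  others and gives \<open>1 - seq_fps b\<close> constant term 1.\<close>

definition seq_fps :: "(nat \<Rightarrow> 'a::field_char_0) \<Rightarrow> 'a fps" where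
  "seq_fps b = Abs_fps (\<lambda>i. if i = 0 then 0 else b i)"

lemma seq_fps_nth: "seq_fps b $ i = (if i = 0 then 0 else b i)"
  by (simp add: seq_fps_def)

text \<open>In the expanded power of the truncated series, the tuple \<open>k\<close> contributes a
  monomial of degree \<open>(\<Sum>i=1..n. i * k i)\<close>, so degree \<open>n\<close> selects the
  weighted tuples.\<close>

lemma seq_fps_power_nth:
  "(seq_fps b ^ m) $ n = fact m *
    (\<Sum>k | k \<in> weighted_tuples n \<and> (\<Sum>i=1..n. k i) = m. (\<Prod>i=1..n. b i ^ k i) / (\<Prod>i=1..n. fact (k i)))"
proof -
  define x where "x i = fps_const (b i) * fps_X ^ i" for i
  define c where "c k = (\<Prod>i=1..n. b i ^ k i) / (\<Prod>i=1..n. fact (k i))" for k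
  have "(\<Prod>i=1..n. fps_const (inverse (fact (k i))) * x i ^ k i) = fps_const (c k) * fps_X ^ (\<Sum>i=1..n. i * k i)"
    for k
  proof -
    have x: "fps_const (inverse (fact (k i))) * x i ^ k i = fps_const (b i ^ k i / fact (k i)) * fps_X ^ (i * k i)"
      for i
      by (simp add: x_def power_mult_distrib power_mult divide_inverse mult_ac flip: mult.assoc)
    have "(\<Prod>i\<in>I. fps_const (b i ^ k i / fact (k i)) * fps_X ^ (i * k i)) =
        fps_const (\<Prod>i\<in>I. b i ^ k i / fact (k i)) * fps_X ^ (\<Sum>i\<in>I. i * k i)"
      if "finite I" for I
      using that
    proof (induction I rule: finite_induct)
      case (insert i I)
      then show ?case by (simp add: power_add mult_ac flip: mult.assoc)
    qed simp
    then show ?thesis by (simp add: c_def x prod_dividef)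
  qed
  moreover have "(seq_fps b ^ m) $ n = ((\<Sum>i=1..n. x i) ^ m) $ n"
    by (rule fps_power_nth_cong[of n]) (auto simp: seq_fps_nth x_def fps_sum_nth if_distrib cong: if_cong)
  ultimately have "(seq_fps b ^ m) $ n =
      fact m * (\<Sum>k\<in>tuples_of_sum {1..n} m. if n = (\<Sum>i=1..n. i * k i) then c k else 0)"
    by (simp add: fps_multinomial fps_sum_nth if_distrib cong: if_cong)
  also have "(\<Sum>k\<in>tuples_of_sum {1..n} m. if n = (\<Sum>i=1..n. i * k i) then c k else 0) =
      (\<Sum>k | k \<in> weighted_tuples n \<and> (\<Sum>i=1..n. k i) = m. c k)"
    by (rule sum.mono_neutral_cong_right)
      (use finite_tuples_of_sum[of "{1..n}" m] in \<open>auto simp: tuples_of_sum_def weighted_tuples_def\<close>)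
  finally show ?thesis by (simp add: c_def)
qed

text \<open>This is the negative binomial series of \<open>1 / (1 - X)^(n+1)\<close> with
  \<open>B\<close> substituted for \<open>X\<close>.\<close>

lemma inverse_one_minus_power_nth:
  fixes B :: "'a::field_char_0 fps"
  assumes B0: "B $ 0 = 0"
  shows "(inverse (1 - B) ^ Suc n) $ j = (\<Sum>m\<le>j. of_nat ((n + m) choose m) * (B ^ m) $ j)"
proof -
  have "inverse ((1 - fps_X :: 'a fps) ^ Suc n) oo B = inverse ((1 - fps_X) ^ Suc n oo B)"
    by (rule fps_inverse_compose) (simp_all add: B0 fps_power_zeroth)
  also have "(1 - fps_X) ^ Suc n oo B = (1 - B) ^ Suc n"
    by (simp add: fps_compose_power[OF B0, symmetric] fps_compose_sub_distrib B0 del: power_Suc)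
  finally have "inverse (1 - B) ^ Suc n = inverse ((1 - fps_X) ^ Suc n) oo B"
    by (simp add: fps_inverse_power del: power_Suc)
  moreover have "inverse ((1 - fps_X :: 'a fps) ^ Suc n) = Abs_fps (\<lambda>m. of_nat ((n + m) choose m))"
    using one_minus_const_fps_X_neg_power'[of "Suc n" "1::'a"] by (simp del: power_Suc)
  ultimately show ?thesis by (simp add: fps_compose_nth atLeast0AtMost)
qed

lemma sum_le_of_weighted_tuples:
  assumes "k \<in> weighted_tuples n"
  shows "(\<Sum>i=1..n. k i) \<le> n"
proof -
  have "(\<Sum>i=1..n. k i) \<le> (\<Sum>i=1..n. i * k i)" by (rule sum_mono) auto
  with assms show ?thesis by (simp add: weighted_tuples_def)
qed

lemma weighted_tuples_sum_eq:
  fixes b :: "nat \<Rightarrow> 'a::field_char_0"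
  shows "(\<Sum>k\<in>weighted_tuples n.
      fact ((\<Sum>i=1..n. k i) + n) / (\<Prod>i=1..n. fact (k i)) * (\<Prod>i=1..n. b i ^ k i)) =
    fact (Suc n) * fps_inv (fps_X * (1 - seq_fps b)) $ Suc n"
proof -
  let ?t = "\<lambda>k. (\<Prod>i=1..n. b i ^ k i) / (\<Prod>i=1..n. fact (k i))"
  have "(\<Sum>k\<in>weighted_tuples n.
      fact ((\<Sum>i=1..n. k i) + n) / (\<Prod>i=1..n. fact (k i)) * (\<Prod>i=1..n. b i ^ k i)) =
      (\<Sum>k\<in>weighted_tuples n. fact ((\<Sum>i=1..n. k i) + n) * ?t k)"
    by simp
  also have "\<dots> = (\<Sum>m\<le>n. \<Sum>k | k \<in> weighted_tuples n \<and> (\<Sum>i=1..n. k i) = m.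
      fact ((\<Sum>i=1..n. k i) + n) * ?t k)"
    by (rule sum.group[symmetric]) (use sum_le_of_weighted_tuples in \<open>auto simp: finite_weighted_tuples\<close>)
  also have "\<dots> = (\<Sum>m\<le>n. fact n * (of_nat ((n + m) choose m) * (seq_fps b ^ m) $ n))"
  proof (intro sum.cong refl)
    fix m
    have "fact n * (of_nat ((n + m) choose m) * fact m) = (fact (m + n) :: 'a)"
      by (simp add: binomial_fact add.commute)
    then show "(\<Sum>k | k \<in> weighted_tuples n \<and> (\<Sum>i=1..n. k i) = m. fact ((\<Sum>i=1..n. k i) + n) * ?t k) =
        fact n * (of_nat ((n + m) choose m) * (seq_fps b ^ m) $ n)"
      by (simp only: seq_fps_power_nth mult.assoc[symmetric])
        (simp add: sum_distrib_left)
  qed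
  also have "\<dots> = fact n * (inverse (1 - seq_fps b) ^ Suc n) $ n"
    by (subst inverse_one_minus_power_nth) (simp_all add: seq_fps_nth sum_distrib_left)
  also have "\<dots> = fact n * (of_nat (Suc n) * fps_inv (fps_X * (1 - seq_fps b)) $ Suc n)"
    by (subst Lagrange_inversion) (simp_all add: seq_fps_nth)
  finally show ?thesis by (simp add: mult_ac)
qed

section \<open>The symmetric form of the condition\<close>

lemma fps_nth_compose_uminus_X: "(f oo - fps_X) $ n = (- 1) ^ n * (f :: 'a::field_char_0 fps) $ n"
  by (simp add: fps_compose_uminus')

lemma all_nat_Suc_iff: "(\<forall>n. P n) \<longleftrightarrow> P 0 \<and> (\<forall>n. P (Suc n))"
  by (metis not0_implies_Suc)

lemma condition_iff:
  fixes a b :: "nat \<Rightarrow> 'a::field_char_0"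
  shows "(\<forall>n\<ge>1. a n = (- 1) ^ (n + 1) / fact (n + 1) *
            (\<Sum>k\<in>weighted_tuples n.
               fact ((\<Sum>i=1..n. k i) + n) / (\<Prod>i=1..n. fact (k i)) * (\<Prod>i=1..n. b i ^ k i)))
     \<longleftrightarrow> fps_X * (1 - seq_fps a) = - (fps_inv (fps_X * (1 - seq_fps b)) oo - fps_X)"
proof -
  let ?G = "fps_inv (fps_X * (1 - seq_fps b))"
  \<comment> \<open>Both series agree in degrees 0 and 1 whatever \<open>a\<close> and
    \<open>b\<close> are, so only the degrees \<open>Suc n\<close> with \<open>n \<ge> 1\<close>
    carry a condition.\<close>
  have G1: "?G $ Suc 0 = 1"
    using Lagrange_inversion[of "1 - seq_fps b" 0] by (simp add: seq_fps_nth)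
  have G0: "?G $ 0 = 0" by (simp add: fps_inv_def)
  have "fps_X * (1 - seq_fps a) = - (?G oo - fps_X) \<longleftrightarrow>
      (\<forall>n. (fps_X * (1 - seq_fps a)) $ Suc n = - (?G oo - fps_X) $ Suc n)"
    unfolding fps_eq_iff using G0 by (subst all_nat_Suc_iff) (simp add: fps_nth_compose_uminus_X)
  also have "\<dots> \<longleftrightarrow> (\<forall>n\<ge>1. a n = (- 1) ^ (n + 1) * ?G $ Suc n)"
  proof (intro all_cong1)
    fix n
    show "(fps_X * (1 - seq_fps a)) $ Suc n = - (?G oo - fps_X) $ Suc n \<longleftrightarrow>
        (1 \<le> n \<longrightarrow> a n = (- 1) ^ (n + 1) * ?G $ Suc n)"
      using G1 by (cases n) (auto simp: fps_nth_compose_uminus_X seq_fps_nth)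
  qed
  finally show ?thesis unfolding weighted_tuples_sum_eq by (simp del: fact_Suc)
qed

text \<open>Conjugation by the involution \<open>X \<mapsto> - X\<close> commutes with taking
  compositional inverses, so the conjugate \<open>h\<close> of \<open>g\<close> is the inverse of
  \<open>f\<close>, and conjugating \<open>h\<close> again returns \<open>g\<close>.\<close>

lemma fps_inv_conjugate_uminus:
  fixes f g :: "'a::field_char_0 fps"
  assumes f0: "f $ 0 = 0" and f1: "f $ 1 \<noteq> 0" and g0: "g $ 0 = 0" and g1: "g $ 1 \<noteq> 0"
    and f: "f = - (fps_inv g oo - fps_X)"
  shows "g = - (fps_inv f oo - fps_X)"
proof -
  have i0: "fps_inv g $ 0 = 0" "fps_inv f $ 0 = 0" by (simp_all add: fps_inv_def)
  define h where "h = - (g oo - fps_X)"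
  have "h oo f = - (g oo (- fps_X oo f))"
    by (simp add: h_def fps_compose_uminus f0 flip: fps_compose_assoc)
  also have "\<dots> = - (g oo (fps_inv g oo - fps_X))"
    by (subst f) (simp add: fps_compose_uminus f0 i0)
  also have "\<dots> = fps_X"
    by (simp add: fps_compose_assoc i0 fps_inv_right[OF g0 g1])
  finally have "h oo f = fps_X" .
  then have "h oo (f oo fps_inv f) = fps_X oo fps_inv f"
    by (simp add: fps_compose_assoc f0 i0)
  then have "h = fps_inv f" by (simp add: fps_inv_right[OF f0 f1] i0)
  moreover have "g = - (h oo - fps_X)"
    by (simp add: fps_eq_iff h_def fps_nth_compose_uminus_X flip: power_add mult.assoc)
  ultimately show ?thesis by simp
qed

theorem theorem4p3:
  fixes \<alpha> \<beta> :: "nat \<Rightarrow> complex"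
  shows "(\<forall>n\<ge>1. \<alpha> n = (- 1) ^ (n + 1) / fact (n + 1) *
            (\<Sum>k\<in>weighted_tuples n.
               fact ((\<Sum>i=1..n. k i) + n) / (\<Prod>i=1..n. fact (k i)) * (\<Prod>i=1..n. \<beta> i ^ k i)))
     \<longleftrightarrow> (\<forall>n\<ge>1. \<beta> n = (- 1) ^ (n + 1) / fact (n + 1) *
            (\<Sum>k\<in>weighted_tuples n.
               fact ((\<Sum>i=1..n. k i) + n) / (\<Prod>i=1..n. fact (k i)) * (\<Prod>i=1..n. \<alpha> i ^ k i)))"
proof -
  have "(fps_X * (1 - seq_fps b)) $ 0 = 0" "(fps_X * (1 - seq_fps b)) $ 1 \<noteq> 0" for b :: "nat \<Rightarrow> complex"
    by (simp_all add: seq_fps_nth)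
  \<comment> \<open>Each direction is one use of the conjugation lemma, with the two series
    exchanged.\<close>
  then show ?thesis
    unfolding condition_iff by (metis fps_inv_conjugate_uminus)
qed

end
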